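(* Let $k\geq 3$ and $n\geq 3$ be integers, and let $C_n$ be the cycle with $n$ vertices. Then $$k\leq \dim_M(And(k)\,\square\, C_n)\leq k+1.$$
   Context: All graphs are finite, simple and undirected. For a connected graph $G$, $d(x,y)$ denotes the length of a shortest path between vertices $x$ and $y$. A set $W\subseteq V(G)$ is a resolving set for $G$ if for each pair of distinct vertices $u,v\in V(G)$ there exists $t\in W$ with $d(u,t)\neq d(v,t)$. The metric dimension $\dim_M(G)$ is the minimum cardinality of a resolving set for $G$. The Cartesian product $G_1\square G_2$ has vertex set $V(G_1)\times V(G_2)$, with $(u,v)$ adjacent to $(u',v')$ whenever $u=u'$ and $vv'\in E(G_2)$, or $v=v'$ and $uu'\in E(G_1)$. For an integer $k\geq 1$, the Andrásfai graph $And(k)$ is the Cayley graph $Cay(\mathbb{Z}_{3k-1},S)$ of the additive group of integers modulo $3k-1$ with $S=\{1,4,7,\ldots,3k-2\}$ (the classes of the integers in $\{1,\ldots,3k-1\}$ congruent to $1$ modulo $3$; $S=-S$ and $0\notin S$). That is, its vertex set is $\mathbb{Z}_{3k-1}$ and two vertices $u,v$ are adjacent if and only if $u-v\in S$. *)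

theory Defs
  imports "Graph_Theory.Graph_Theory" "HOL-Algebra.Elementary_Groups"
begin

text \<open>
  A finite simple undirected graph is a \<open>pair_graph\<close>: a finite loop-free symmetric
  relation on a finite vertex set, each edge being represented by its two opposite arcs.
  The three graph constructions below are proved to satisfy this locale, and to be connected
  in the relevant parameter range.
\<close>

section \<open>Distance and metric dimension\<close>

text \<open>
  The value is unspecified if \<open>v\<close> is not reachable from \<open>u\<close>; it is only meant to be used
  in connected graphs.
\<close>

definition graph_dist :: "('a, 'b) pre_digraph \<Rightarrow> 'a \<Rightarrow> 'a \<Rightarrow> nat" where
  "graph_dist G u v = (LEAST l. \<exists>p. pre_digraph.apath G u p v \<and> length p = l)"

definition resolving_set :: "('a, 'b) pre_digraph \<Rightarrow> 'a set \<Rightarrow> bool" where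
  "resolving_set G W \<longleftrightarrow> W \<subseteq> verts G \<and>
    (\<forall>u\<in>verts G. \<forall>v\<in>verts G. u \<noteq> v \<longrightarrow> (\<exists>t\<in>W. graph_dist G u t \<noteq> graph_dist G v t))"

definition metric_dimension :: "('a, 'b) pre_digraph \<Rightarrow> nat" where
  "metric_dimension G = (LEAST m. \<exists>W. resolving_set G W \<and> card W = m)"

section \<open>Graph constructions\<close>

definition cartesian_product ::
    "'a pair_pre_digraph \<Rightarrow> 'b pair_pre_digraph \<Rightarrow> ('a \<times> 'b) pair_pre_digraph"
    (infixr \<open>\<box>\<close> 70) where
  "G \<box> H = \<lparr> pverts = pverts G \<times> pverts H,
    parcs = {((u, v), (u', v')).
        (u \<in> pverts G \<and> u = u' \<and> (v, v') \<in> parcs H) \<or>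
        (v \<in> pverts H \<and> v = v' \<and> (u, u') \<in> parcs G)} \<rparr>"

definition cayley_graph :: "('a, 'c) monoid_scheme \<Rightarrow> 'a set \<Rightarrow> 'a pair_pre_digraph" where
  "cayley_graph \<Gamma> S = \<lparr> pverts = carrier \<Gamma>,
    parcs = {(u, v). u \<in> carrier \<Gamma> \<and> v \<in> carrier \<Gamma> \<and> u \<otimes>\<^bsub>\<Gamma>\<^esub> inv\<^bsub>\<Gamma>\<^esub> v \<in> S} \<rparr>"

text \<open>
  The group \<open>integer_mod_group m\<close> has carrier \<open>{0..<int m}\<close> for \<open>m > 0\<close>. The upper end
  \<open>3 * k - 1\<close> of the range of \<open>s\<close> is congruent to 2 modulo 3, so every \<open>s\<close> in the connection
  set is the canonical representative of its class.
\<close>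

definition Andrasfai :: "nat \<Rightarrow> int pair_pre_digraph" where
  "Andrasfai k = cayley_graph (integer_mod_group (3 * k - 1))
    {s \<in> {1..3 * int k - 1}. s mod 3 = 1}"

definition cycle_graph :: "nat \<Rightarrow> nat pair_pre_digraph" where
  "cycle_graph n = \<lparr> pverts = {0..<n},
    parcs = {(i, j). i < n \<and> j < n \<and> (j = (i + 1) mod n \<or> i = (j + 1) mod n)} \<rparr>"

section \<open>Basic facts\<close>

lemma (in wf_digraph) graph_dist_eq_\<mu>:
  assumes "u \<rightarrow>\<^sup>* v"
  shows "ereal (real (graph_dist G u v)) = \<mu> (\<lambda>_. 1) u v"
proof -
  let ?P = "\<lambda>l. \<exists>p. apath u p v \<and> length p = l"
  have cost: "awalk_cost (\<lambda>_. 1) p = real (length p)" for p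
    by (induction p) auto
  have "\<exists>l. ?P l" using assms reachable_apath by auto
  then have "?P (graph_dist G u v)" unfolding graph_dist_def by (rule LeastI_ex)
  then obtain p where p: "apath u p v" "length p = graph_dist G u v" by auto
  have least: "graph_dist G u v \<le> length q" if "awalk u q v" for q
  proof -
    have "apath u (awalk_to_apath q) v" using that by (rule apath_awalk_to_apath)
    then have "graph_dist G u v \<le> length (awalk_to_apath q)"
      unfolding graph_dist_def by (intro Least_le) auto
    also have "\<dots> \<le> length q" using awalk_to_path_no_neg_cyc_cost[OF that, of "\<lambda>_. 1"] by (simp add: cost)
    finally show ?thesis .
  qed
  have "\<mu> (\<lambda>_. 1) u v = ereal (real (graph_dist G u v))"
    unfolding \<mu>_def cost
  proof (rule INF_eqI)
    fix y assume "\<And>q. q \<in> {q. awalk u q v} \<Longrightarrow> y \<le> ereal (real (length q))"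
    from this[of p] show "y \<le> ereal (real (graph_dist G u v))"
      using p by (simp add: awalkI_apath)
  qed (use least in auto)
  then show ?thesis by simp
qed

lemma (in wf_digraph) graph_dist_eq_0_iff:
  assumes "u \<rightarrow>\<^sup>* v"
  shows "graph_dist G u v = 0 \<longleftrightarrow> u = v"
proof -
  let ?P = "\<lambda>l. \<exists>p. apath u p v \<and> length p = l"
  have "\<exists>l. ?P l" using assms reachable_apath by auto
  then have P: "?P (graph_dist G u v)" unfolding graph_dist_def by (rule LeastI_ex)
  have "u \<in> verts G" using assms reachable_in_verts by auto
  then have "apath u [] u" by (simp add: apath_Nil_iff)
  then have "graph_dist G u u = 0" unfolding graph_dist_def by (intro Least_eq_0) auto
  moreover have "u = v" if "graph_dist G u v = 0"
    using P that by (simp add: apath_Nil_iff)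
  ultimately show ?thesis by blast
qed

lemma (in wf_digraph) resolving_set_verts:
  assumes "strongly_connected G"
  shows "resolving_set G (verts G)"
  unfolding resolving_set_def
proof (intro conjI ballI impI)
  fix u v assume "u \<in> verts G" "v \<in> verts G" "u \<noteq> v"
  moreover from this have "u \<rightarrow>\<^sup>* v" "v \<rightarrow>\<^sup>* v"
    using assms by (auto simp: strongly_connected_def)
  ultimately have "graph_dist G u v \<noteq> 0" "graph_dist G v v = 0"
    using graph_dist_eq_0_iff by auto
  then show "\<exists>t\<in>verts G. graph_dist G u t \<noteq> graph_dist G v t"
    using \<open>v \<in> verts G\<close> by (intro bexI[of _ v]) auto
qed simp

lemma (in wf_digraph) metric_dimension_attained:
  assumes "strongly_connected G"
  shows "\<exists>W. resolving_set G W \<and> card W = metric_dimension G"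
proof -
  have "\<exists>m W. resolving_set G W \<and> card W = m" using resolving_set_verts[OF assms] by blast
  then show ?thesis unfolding metric_dimension_def by (rule LeastI_ex)
qed

lemma pair_graphI:
  assumes "finite (pverts G)" "\<And>u v. (u, v) \<in> parcs G \<Longrightarrow> u \<in> pverts G \<and> v \<in> pverts G"
    "\<And>u v. (u, v) \<in> parcs G \<Longrightarrow> (v, u) \<in> parcs G" "\<And>u. (u, u) \<notin> parcs G"
  shows "pair_graph G"
proof -
  have "parcs G \<subseteq> pverts G \<times> pverts G" using assms(2) by auto
  then have "finite (parcs G)" using assms(1) by (meson finite_SigmaI finite_subset)
  then show ?thesis
    using assms by unfold_locales (auto simp: symmetric_def sym_def)
qed

lemma pverts_cartesian_product: "pverts (G \<box> H) = pverts G \<times> pverts H"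
  by (simp add: cartesian_product_def)

lemma pair_graph_cartesian_product:
  assumes "pair_graph G" "pair_graph H"
  shows "pair_graph (G \<box> H)"
proof -
  interpret G: pair_graph G by fact
  interpret H: pair_graph H by fact
  have s: "(v, u) \<in> parcs G" if "(u, v) \<in> parcs G" for u v
    using G.pair_sym_arcs that by (auto simp: symmetric_def sym_def)
  have t: "(v, u) \<in> parcs H" if "(u, v) \<in> parcs H" for u v
    using H.pair_sym_arcs that by (auto simp: symmetric_def sym_def)
  show ?thesis
    by (rule pair_graphI)
      (auto simp: cartesian_product_def G.pair_finite_verts H.pair_finite_verts
        dest: s t G.in_arcsD1 G.in_arcsD2 H.in_arcsD1 H.in_arcsD2 G.pair_no_loops H.pair_no_loops)
qed

lemma pverts_Andrasfai: "k \<ge> 1 \<Longrightarrow> pverts (Andrasfai k) = {0..<3 * int k - 1}"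
  by (auto simp: Andrasfai_def cayley_graph_def carrier_integer_mod_group)

lemma parcs_Andrasfai_iff:
  assumes "k \<ge> 1"
  shows "(u, v) \<in> parcs (Andrasfai k) \<longleftrightarrow>
    u \<in> {0..<3 * int k - 1} \<and> v \<in> {0..<3 * int k - 1} \<and> (u - v) mod (3 * int k - 1) mod 3 = 1"
proof -
  have m: "int (3 * k - 1) = 3 * int k - 1" using assms by linarith
  have c: "carrier (integer_mod_group (3 * k - 1)) = {0..<3 * int k - 1}"
    using assms by (auto simp: carrier_integer_mod_group m)
  have "(u, v) \<in> parcs (Andrasfai k) \<longleftrightarrow>
    u \<in> {0..<3 * int k - 1} \<and> v \<in> {0..<3 * int k - 1} \<and>
    (u - v) mod (3 * int k - 1) \<in> {s \<in> {1..3 * int k - 1}. s mod 3 = 1}"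
  proof (cases "v \<in> {0..<3 * int k - 1}")
    case True
    then have "inv\<^bsub>integer_mod_group (3 * k - 1)\<^esub> v = (- v) mod (3 * int k - 1)"
      by (subst inv_integer_mod_group) (simp_all only: c m)
    moreover have "(u + (- v) mod (3 * int k - 1)) mod (3 * int k - 1) = (u - v) mod (3 * int k - 1)"
      by (simp add: mod_add_right_eq)
    ultimately show ?thesis
      unfolding Andrasfai_def cayley_graph_def using True by (simp add: c m del: One_nat_def)
  next
    case False
    then show ?thesis
      unfolding Andrasfai_def cayley_graph_def by (simp add: c del: One_nat_def atLeastLessThan_iff)
  qed
  moreover have "x mod (3 * int k - 1) \<in> {s \<in> {1..3 * int k - 1}. s mod 3 = 1} \<longleftrightarrow>
      x mod (3 * int k - 1) mod 3 = 1" for x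
  proof -
    have "0 \<le> x mod (3 * int k - 1)" "x mod (3 * int k - 1) < 3 * int k - 1" using assms by auto
    moreover have "y \<in> {s \<in> {1..3 * int k - 1}. s mod 3 = 1} \<longleftrightarrow> y mod 3 = 1"
      if "0 \<le> y" "y < 3 * int k - 1" for y using that by (cases "y = 0") auto
    ultimately show ?thesis by blast
  qed
  ultimately show ?thesis by simp
qed

lemma pair_graph_Andrasfai:
  assumes "k \<ge> 1"
  shows "pair_graph (Andrasfai k)"
proof (rule pair_graphI)
  fix u v assume uv: "(u, v) \<in> parcs (Andrasfai k)"
  let ?m = "3 * int k - 1" and ?x = "(u - v) mod (3 * int k - 1)"
  have x: "?x mod 3 = 1" using uv assms parcs_Andrasfai_iff by auto
  then have "(v - u) mod ?m = ?m - ?x"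
    using zmod_zminus1_eq_if[of "u - v" ?m] by auto
  moreover have "(3 * int k - 1 - y) mod 3 = 1" if "y mod 3 = 1" for y :: int using that by presburger
  ultimately show "(v, u) \<in> parcs (Andrasfai k)"
    using uv assms x by (simp add: parcs_Andrasfai_iff)
next
  show "finite (pverts (Andrasfai k))" using assms by (simp add: pverts_Andrasfai)
  show "u \<in> pverts (Andrasfai k) \<and> v \<in> pverts (Andrasfai k)" if "(u, v) \<in> parcs (Andrasfai k)" for u v
    using that unfolding Andrasfai_def cayley_graph_def by simp
  show "(u, u) \<notin> parcs (Andrasfai k)" for u
    by (simp add: parcs_Andrasfai_iff[OF assms] del: atLeastLessThan_iff)
qed

lemma pverts_cycle_graph: "pverts (cycle_graph n) = {0..<n}"
  by (simp add: cycle_graph_def)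

lemma pair_graph_cycle_graph:
  assumes "n \<ge> 2"
  shows "pair_graph (cycle_graph n)"
proof (rule pair_graphI)
  show "(u, u) \<notin> parcs (cycle_graph n)" for u
    using assms by (cases "u + 1 = n") (auto simp: cycle_graph_def)
next
  show "finite (pverts (cycle_graph n))" by (simp add: cycle_graph_def)
  show "u \<in> pverts (cycle_graph n) \<and> v \<in> pverts (cycle_graph n)" if "(u, v) \<in> parcs (cycle_graph n)" for u v
    using that by (simp add: cycle_graph_def)
  show "(v, u) \<in> parcs (cycle_graph n)" if "(u, v) \<in> parcs (cycle_graph n)" for u v
    using that unfolding cycle_graph_def by (simp; blast)
qed

lemma strongly_connected_via_root:
  assumes "pair_graph G" "r \<in> pverts G" "\<And>v. v \<in> pverts G \<Longrightarrow> r \<rightarrow>\<^sup>*\<^bsub>G\<^esub> v"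
  shows "strongly_connected (with_proj G)"
proof -
  interpret pair_graph G by fact
  show ?thesis
    unfolding strongly_connected_def
    using assms symmetric_reachable[OF sym_arcs] reachable_trans
    by (metis empty_iff with_proj_simps(1))
qed

lemma strongly_connected_Andrasfai:
  assumes "k \<ge> 1"
  shows "strongly_connected (with_proj (Andrasfai k))"
proof -
  interpret pair_graph "Andrasfai k" using assms by (rule pair_graph_Andrasfai)
  have "0 \<rightarrow>\<^sup>*\<^bsub>with_proj (Andrasfai k)\<^esub> int i" if "int i < 3 * int k - 1" for i
    using that
  proof (induction i)
    case 0
    then show ?case using assms by (simp add: pverts_Andrasfai)
  next
    case (Suc i)
    have "(int (Suc i), int i) \<in> parcs (Andrasfai k)"
      using Suc.prems assms by (simp add: parcs_Andrasfai_iff)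
    then have "(int i, int (Suc i)) \<in> parcs (Andrasfai k)"
      using pair_sym_arcs by (auto simp: symmetric_def sym_def)
    then show ?case using Suc by (auto intro: reachable_adj_trans)
  qed
  then have "0 \<rightarrow>\<^sup>*\<^bsub>with_proj (Andrasfai k)\<^esub> v" if "v \<in> pverts (Andrasfai k)" for v
    using that assms by (metis atLeastLessThan_iff pverts_Andrasfai zero_le_imp_eq_int)
  then show ?thesis
    using assms by (intro strongly_connected_via_root[of _ 0])
      (auto simp: pverts_Andrasfai pair_graph_Andrasfai)
qed

lemma strongly_connected_cycle_graph:
  assumes "n \<ge> 2"
  shows "strongly_connected (with_proj (cycle_graph n))"
proof -
  interpret pair_graph "cycle_graph n" using assms by (rule pair_graph_cycle_graph)
  have "0 \<rightarrow>\<^sup>*\<^bsub>with_proj (cycle_graph n)\<^esub> i" if "i < n" for i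
    using that
  proof (induction i)
    case 0
    then show ?case by (intro reachable_refl) (simp add: cycle_graph_def)
  next
    case (Suc i)
    have "(i, Suc i) \<in> parcs (cycle_graph n)" using Suc.prems by (simp add: cycle_graph_def)
    then show ?case using Suc by (auto intro: reachable_adj_trans)
  qed
  then show ?thesis
    using assms by (intro strongly_connected_via_root[of _ 0])
      (simp_all add: pverts_cycle_graph pair_graph_cycle_graph)
qed

lemma strongly_connected_cartesian_product:
  assumes "pair_graph G" "pair_graph H"
    and "strongly_connected (with_proj G)" "strongly_connected (with_proj H)"
  shows "strongly_connected (with_proj (G \<box> H))"
proof -
  interpret G: pair_graph G by fact
  interpret H: pair_graph H by fact
  interpret GH: pair_graph "G \<box> H" using assms(1,2) by (rule pair_graph_cartesian_product)
  have 1: "(u, w) \<rightarrow>\<^sup>*\<^bsub>with_proj (G \<box> H)\<^esub> (v, w)"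
    if "u \<rightarrow>\<^sup>*\<^bsub>with_proj G\<^esub> v" "w \<in> pverts H" for u v w
    using that(1)
  proof (induction rule: G.reachable_induct)
    case base
    then show ?case
      using that(2) by (intro GH.reachable_refl) (simp add: pverts_cartesian_product)
  next
    case (step x y)
    then have "((x, w), (y, w)) \<in> parcs (G \<box> H)" using that(2) by (simp add: cartesian_product_def)
    then show ?case using step by (auto intro: GH.reachable_adj_trans)
  qed
  have 2: "(w, u) \<rightarrow>\<^sup>*\<^bsub>with_proj (G \<box> H)\<^esub> (w, v)"
    if "u \<rightarrow>\<^sup>*\<^bsub>with_proj H\<^esub> v" "w \<in> pverts G" for u v w
    using that(1)
  proof (induction rule: H.reachable_induct)
    case base
    then show ?case
      using that(2) by (intro GH.reachable_refl) (simp add: pverts_cartesian_product)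
  next
    case (step x y)
    then have "((w, x), (w, y)) \<in> parcs (G \<box> H)" using that(2) by (simp add: cartesian_product_def)
    then show ?case using step by (auto intro: GH.reachable_adj_trans)
  qed
  have "(u, v) \<rightarrow>\<^sup>*\<^bsub>with_proj (G \<box> H)\<^esub> (u', v')"
    if "u \<in> pverts G" "u' \<in> pverts G" "v \<in> pverts H" "v' \<in> pverts H" for u u' v v'
  proof -
    have "u \<rightarrow>\<^sup>*\<^bsub>with_proj G\<^esub> u'" "v \<rightarrow>\<^sup>*\<^bsub>with_proj H\<^esub> v'"
      using that assms(3,4) by (auto simp: strongly_connected_def)
    then show ?thesis using that 1 2 GH.reachable_trans by metis
  qed
  then show ?thesis
    using assms(3,4) by (auto simp: strongly_connected_def pverts_cartesian_product)
qed

end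

theory Submission
  imports Defs
begin

text \<open>
  Distances in a Cartesian product add up coordinatewise. Two vertices with the same second
  coordinate can therefore only be separated through their first coordinates, so a resolving set
  of \<open>G \<box> H\<close> projects to a resolving set of \<open>G\<close>. In the other direction, call \<open>S\<close> doubly
  resolving for \<open>G\<close> if no two distinct vertices have distance vectors to \<open>S\<close> that differ by a
  constant. Such an \<open>S\<close>, placed in one fibre over \<open>t\<^sub>0\<close>, determines the first coordinate of a vertex of
  \<open>G \<box> H\<close>, because the second coordinate only shifts the vector by a constant; a resolving set
  of \<open>H\<close> placed in a fibre of the other kind then determines the second coordinate. The two copies
  share a vertex, so \<open>card S + card T - 1\<close> vertices suffice.

  Hence it is enough to show that every resolving set of \<open>And(k)\<close> has at least \<open>k\<close> elements, and
  that \<open>And(k)\<close> has a doubly resolving set of size \<open>k\<close>; the cycle is resolved by two adjacent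
  vertices. Write \<open>m = 3k - 1\<close> for the order of \<open>And(k)\<close>, a graph of diameter at most 2.

  \<^item> Lower bound (\<open>card_le_resolving_set_Andrasfai\<close>). If \<open>W\<close> is resolving, then vertices
    outside \<open>W\<close> are told apart by their neighbourhoods in \<open>W\<close> alone, all distances to \<open>W\<close> being
    1 or 2. Run through the vertices in the order \<open>0, 3, 6, \<dots>\<close> modulo \<open>m\<close>. The neighbourhoods of
    \<open>x\<close> and \<open>x + 3\<close> differ exactly in \<open>x + 1\<close> and \<open>x + 2\<close>, so along this walk the trace on \<open>W\<close> changes
    at most \<open>2 |W|\<close> times and takes at most \<open>2 |W| + 1\<close> values. Thus \<open>m - |W| \<le> 2 |W| + 1\<close>, that
    is, \<open>3k - 2 \<le> 3 |W|\<close>, which forces \<open>k \<le> |W|\<close>.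

  \<^item> Upper bound (\<open>doubly_resolving_set_Andrasfai\<close>). Take \<open>S = {0, 3, \<dots>, 3(k - 1)}\<close>. The
    distance vector to \<open>S\<close> is constant 2 except for a single 0 if \<open>x \<equiv> 0\<close> modulo 3, has the form
    \<open>1 \<dots> 1 2 \<dots> 2\<close> if \<open>x \<equiv> 1\<close>, and the form \<open>2 \<dots> 2 1 \<dots> 1\<close> with both values occurring if
    \<open>x \<equiv> 2\<close>. No two of these vectors differ by a constant.
\<close>

section \<open>Shortest walks\<close>

lemma (in wf_digraph) graph_dist_le_awalk_length:
  assumes "awalk u q v"
  shows "graph_dist G u v \<le> length q"
proof -
  have cost: "awalk_cost (\<lambda>_. 1) p = real (length p)" for p
    by (induction p) auto
  have "apath u (awalk_to_apath q) v" using assms by (rule apath_awalk_to_apath)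
  then have "graph_dist G u v \<le> length (awalk_to_apath q)"
    unfolding graph_dist_def by (intro Least_le) auto
  also have "\<dots> \<le> length q"
    using awalk_to_path_no_neg_cyc_cost[OF assms, of "\<lambda>_. 1"] by (simp add: cost)
  finally show ?thesis .
qed

lemma (in wf_digraph) shortest_awalk:
  assumes "u \<rightarrow>\<^sup>* v"
  obtains p where "awalk u p v" "length p = graph_dist G u v"
proof -
  have "\<exists>l p. apath u p v \<and> length p = l" using assms reachable_apath by auto
  then have "\<exists>p. apath u p v \<and> length p = graph_dist G u v"
    unfolding graph_dist_def by (rule LeastI_ex)
  then show thesis using that awalkI_apath by blast
qed

lemma (in wf_digraph) graph_dist_le_Suc:
  assumes "u \<rightarrow> v" "v \<rightarrow>\<^sup>* t"
  shows "graph_dist G u t \<le> Suc (graph_dist G v t)"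
proof -
  obtain p where p: "awalk v p t" "length p = graph_dist G v t"
    using assms(2) by (rule shortest_awalk)
  obtain e where "e \<in> arcs G" "tail G e = u" "head G e = v"
    using assms(1) by (auto simp: arcs_ends_def arc_to_ends_def)
  then have "awalk u (e # p) t" using p by (simp add: awalk_Cons_iff)
  from graph_dist_le_awalk_length[OF this] show ?thesis using p by simp
qed

lemma (in wf_digraph) graph_dist_closer_neighbour:
  assumes "u \<rightarrow>\<^sup>* t" "u \<noteq> t"
  obtains v where "u \<rightarrow> v" "graph_dist G v t < graph_dist G u t"
proof -
  obtain p where p: "awalk u p t" "length p = graph_dist G u t"
    using assms(1) by (rule shortest_awalk)
  show thesis
  proof (cases p)
    case Nil
    then show thesis using p assms(2) by (simp add: awalk_Nil_iff)
  next
    case (Cons e q)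
    then have q: "e \<in> arcs G" "u = tail G e" "awalk (head G e) q t"
      using p by (auto simp: awalk_Cons_iff)
    show thesis
      using that[of "head G e"] graph_dist_le_awalk_length[OF q(3)] q Cons p(2)
      by (simp add: in_arcs_imp_in_arcs_ends)
  qed
qed

text \<open>
  All concrete distances below are computed by guessing a formula \<open>f\<close> and checking it locally: a
  function that drops by at most 1 along each arc is a lower bound for the distance to its zero
  \<open>t\<close>, and following arcs along which it decreases reaches \<open>t\<close> in at most \<open>f x\<close> steps.
\<close>

lemma (in wf_digraph) graph_dist_eqI:
  assumes "x \<in> verts G" "f t = 0"
    and lip: "\<And>x y. x \<rightarrow> y \<Longrightarrow> f x \<le> Suc (f y)"
    and desc: "\<And>x. x \<in> verts G \<Longrightarrow> x \<noteq> t \<Longrightarrow> \<exists>y. x \<rightarrow> y \<and> f y < f x"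
  shows "graph_dist G x t = f x"
proof -
  have le: "f x \<le> length p" if "awalk x p t" for p x
    using that
  proof (induction p arbitrary: x)
    case Nil
    then show ?case using assms(2) by (simp add: awalk_Nil_iff)
  next
    case (Cons e p)
    then have "x \<rightarrow> head G e" "f (head G e) \<le> length p"
      by (auto simp: awalk_Cons_iff in_arcs_imp_in_arcs_ends)
    then show ?case using lip by fastforce
  qed
  have "\<exists>p. awalk x p t \<and> length p \<le> f x" using assms(1)
  proof (induction "f x" arbitrary: x rule: less_induct)
    case less
    show ?case
    proof (cases "x = t")
      case True
      then show ?thesis using less.prems by (intro exI[of _ "[]"]) (simp add: awalk_Nil_iff)
    next
      case False
      then obtain y where y: "x \<rightarrow> y" "f y < f x" using desc less.prems by blast
      moreover have "y \<in> verts G" using y(1) by auto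
      ultimately obtain p where p: "awalk y p t" "length p \<le> f y" using less.hyps by blast
      obtain e where "e \<in> arcs G" "tail G e = x" "head G e = y"
        using y(1) by (auto simp: arcs_ends_def arc_to_ends_def)
      then have "awalk x (e # p) t" "length (e # p) \<le> f x"
        using p y(2) by (simp_all add: awalk_Cons_iff)
      then show ?thesis by blast
    qed
  qed
  then obtain p where p: "awalk x p t" "length p \<le> f x" by blast
  then have "x \<rightarrow>\<^sup>* t" using reachable_awalk by blast
  then obtain q where "awalk x q t" "length q = graph_dist G x t" by (rule shortest_awalk)
  then show ?thesis using le[of x q] p graph_dist_le_awalk_length[OF p(1)] by simp
qed

section \<open>Resolving sets of Cartesian products\<close>

lemma metric_dimension_le:
  "resolving_set G W \<Longrightarrow> metric_dimension G \<le> card W"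
  unfolding metric_dimension_def by (rule Least_le) blast

text \<open>
  The sum of the distances in the factors is a potential in the sense of \<open>graph_dist_eqI\<close>: an arc of
  the product moves one coordinate only, and a vertex other than the target has a coordinate in which it
  can get closer.
\<close>

lemma graph_dist_cartesian_product:
  assumes "pair_graph G" "pair_graph H"
    and "strongly_connected (with_proj G)" "strongly_connected (with_proj H)"
    and "u \<in> pverts G" "s \<in> pverts G" "v \<in> pverts H" "t \<in> pverts H"
  shows "graph_dist (with_proj (G \<box> H)) (u, v) (s, t) =
    graph_dist (with_proj G) u s + graph_dist (with_proj H) v t"
proof -
  interpret G: pair_graph G by fact
  interpret H: pair_graph H by fact
  interpret GH: pair_graph "G \<box> H" using assms(1,2) by (rule pair_graph_cartesian_product)
  let ?g = "\<lambda>u. graph_dist (with_proj G) u s" and ?h = "\<lambda>v. graph_dist (with_proj H) v t"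
  have rG: "x \<rightarrow>\<^sup>*\<^bsub>with_proj G\<^esub> s" if "x \<in> pverts G" for x
    using that assms by (auto simp: strongly_connected_def)
  have rH: "y \<rightarrow>\<^sup>*\<^bsub>with_proj H\<^esub> t" if "y \<in> pverts H" for y
    using that assms by (auto simp: strongly_connected_def)
  have "graph_dist (with_proj (G \<box> H)) (u, v) (s, t) = (case (u, v) of (x, y) \<Rightarrow> ?g x + ?h y)"
  proof (rule GH.graph_dist_eqI)
    show "(u, v) \<in> pverts (G \<box> H)" using assms by (simp add: pverts_cartesian_product)
    show "(case (s, t) of (x, y) \<Rightarrow> ?g x + ?h y) = 0"
      using G.graph_dist_eq_0_iff rG H.graph_dist_eq_0_iff rH assms by simp
  next
    fix a b :: "'a \<times> 'b"
    assume "(a, b) \<in> parcs (G \<box> H)"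
    moreover have "?g x \<le> Suc (?g x')" if "(x, x') \<in> parcs G" for x x'
      using that G.graph_dist_le_Suc[of x x' s] rG G.in_arcsD2 by auto
    moreover have "?h y \<le> Suc (?h y')" if "(y, y') \<in> parcs H" for y y'
      using that H.graph_dist_le_Suc[of y y' t] rH H.in_arcsD2 by auto
    ultimately show "(case a of (x, y) \<Rightarrow> ?g x + ?h y) \<le> Suc (case b of (x, y) \<Rightarrow> ?g x + ?h y)"
      by (auto simp: cartesian_product_def split: prod.splits)
  next
    fix a assume a: "a \<in> pverts (G \<box> H)" "a \<noteq> (s, t)"
    obtain x y where xy: "a = (x, y)" by fastforce
    have V: "x \<in> pverts G" "y \<in> pverts H" using a xy by (auto simp: pverts_cartesian_product)
    show "\<exists>b. (a, b) \<in> parcs (G \<box> H) \<and>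
        (case b of (x, y) \<Rightarrow> ?g x + ?h y) < (case a of (x, y) \<Rightarrow> ?g x + ?h y)"
    proof (cases "x = s")
      case False
      then obtain x' where "(x, x') \<in> parcs G" "?g x' < ?g x"
        using G.graph_dist_closer_neighbour[OF rG[OF V(1)]] by auto
      then show ?thesis using V xy
        by (intro exI[of _ "(x', y)"]) (simp add: cartesian_product_def)
    next
      case True
      then have "y \<noteq> t" using a xy by simp
      then obtain y' where "(y, y') \<in> parcs H" "?h y' < ?h y"
        using H.graph_dist_closer_neighbour[OF rH[OF V(2)]] by auto
      then show ?thesis using V xy
        by (intro exI[of _ "(x, y')"]) (simp add: cartesian_product_def)
    qed
  qed
  then show ?thesis by simp
qed

text \<open>
  For two vertices in the same fibre over \<open>y\<close> the contribution of the second coordinate to the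
  distances cancels.
\<close>

lemma resolving_set_fst_image:
  assumes "pair_graph G" "pair_graph H"
    and "strongly_connected (with_proj G)" "strongly_connected (with_proj H)"
    and "resolving_set (with_proj (G \<box> H)) W"
  shows "resolving_set (with_proj G) (fst ` W)"
  unfolding resolving_set_def
proof (intro conjI ballI impI)
  have W: "W \<subseteq> pverts G \<times> pverts H"
    using assms(5) by (simp add: resolving_set_def pverts_cartesian_product)
  then show "fst ` W \<subseteq> verts (with_proj G)" by auto
  obtain y where y: "y \<in> pverts H" using assms(4) by (auto simp: strongly_connected_def)
  fix u v assume uv: "u \<in> verts (with_proj G)" "v \<in> verts (with_proj G)" "u \<noteq> v"
  then obtain s t where st: "(s, t) \<in> W"
    "graph_dist (with_proj (G \<box> H)) (u, y) (s, t) \<noteq> graph_dist (with_proj (G \<box> H)) (v, y) (s, t)"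
    using assms(5) y unfolding resolving_set_def by (fastforce simp: pverts_cartesian_product)
  moreover have "s \<in> pverts G" "t \<in> pverts H" using st W by auto
  ultimately have "graph_dist (with_proj G) u s \<noteq> graph_dist (with_proj G) v s"
    using graph_dist_cartesian_product[OF assms(1-4)] uv y by simp
  then show "\<exists>t\<in>fst ` W. graph_dist (with_proj G) u t \<noteq> graph_dist (with_proj G) v t"
    using st(1) by force
qed

text \<open>
  The defining condition is
  \<open>d(u,s) - d(u,t) \<noteq> d(v,s) - d(v,t)\<close> with the terms regrouped so that it reads: the
  difference of the distance vectors of \<open>u\<close> and \<open>v\<close> is not constant on \<open>S\<close>.
\<close>

definition doubly_resolving_set :: "('a, 'b) pre_digraph \<Rightarrow> 'a set \<Rightarrow> bool" where
  "doubly_resolving_set G S \<longleftrightarrow> S \<subseteq> verts G \<and>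
    (\<forall>u\<in>verts G. \<forall>v\<in>verts G. u \<noteq> v \<longrightarrow> (\<exists>s\<in>S. \<exists>t\<in>S.
      int (graph_dist G u s) - int (graph_dist G v s) \<noteq>
      int (graph_dist G u t) - int (graph_dist G v t)))"

text \<open>
  If \<open>(x, y)\<close> and \<open>(x', y')\<close> have equal distances to \<open>S \<times> {t0}\<close>, then the distance vectors of \<open>x\<close>
  and \<open>x'\<close> to \<open>S\<close> differ by the constant \<open>d(y', t0) - d(y, t0)\<close>, so \<open>x = x'\<close>. Given this, equal
  distances to \<open>{s0} \<times> T\<close> mean that \<open>y\<close> and \<open>y'\<close> are not separated by \<open>T\<close>.
\<close>

lemma resolving_set_cartesian_product:
  assumes "pair_graph G" "pair_graph H"
    and "strongly_connected (with_proj G)" "strongly_connected (with_proj H)"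
    and S: "doubly_resolving_set (with_proj G) S" "s0 \<in> S"
    and T: "resolving_set (with_proj H) T" "t0 \<in> T"
  shows "resolving_set (with_proj (G \<box> H)) (S \<times> {t0} \<union> {s0} \<times> T)"
proof -
  let ?W = "S \<times> {t0} \<union> {s0} \<times> T"
  let ?d = "graph_dist (with_proj (G \<box> H))"
  have ST: "S \<subseteq> pverts G" "T \<subseteq> pverts H"
    using S T by (simp_all add: doubly_resolving_set_def resolving_set_def)
  have d: "?d (x, y) (s, t) = graph_dist (with_proj G) x s + graph_dist (with_proj H) y t"
    if "x \<in> pverts G" "y \<in> pverts H" "(s, t) \<in> ?W" for x y s t
    using that ST S(2) T(2) by (intro graph_dist_cartesian_product[OF assms(1-4)]) auto
  have "(x, y) = (x', y')"
    if V: "x \<in> pverts G" "y \<in> pverts H" "x' \<in> pverts G" "y' \<in> pverts H"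
      and eq: "\<forall>w\<in>?W. ?d (x, y) w = ?d (x', y') w" for x y x' y'
  proof -
    have "int (graph_dist (with_proj G) x s) - int (graph_dist (with_proj G) x' s) =
        int (graph_dist (with_proj H) y' t0) - int (graph_dist (with_proj H) y t0)" if "s \<in> S" for s
      using bspec[OF eq, of "(s, t0)"] that V by (simp add: d)
    then have x: "x = x'" using S(1) V unfolding doubly_resolving_set_def by fastforce
    have "graph_dist (with_proj H) y t = graph_dist (with_proj H) y' t" if "t \<in> T" for t
      using bspec[OF eq, of "(s0, t)"] that V x by (simp add: d)
    then have "y = y'" using T(1) V unfolding resolving_set_def by fastforce
    then show ?thesis using x by simp
  qed
  moreover have "?W \<subseteq> pverts G \<times> pverts H" using ST S(2) T(2) by auto
  ultimately show ?thesis unfolding resolving_set_def by (fastforce simp: pverts_cartesian_product)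
qed

lemma card_resolving_set_cartesian_product:
  assumes "finite S" "finite T" "s0 \<in> S" "t0 \<in> T"
  shows "card (S \<times> {t0} \<union> {s0} \<times> T) + 1 = card S + card T"
proof -
  have "S \<times> {t0} \<inter> {s0} \<times> T = {(s0, t0)}" using assms by auto
  then show ?thesis
    using card_Un_Int[of "S \<times> {t0}" "{s0} \<times> T"] assms by (simp add: card_cartesian_product)
qed

section \<open>Cycles\<close>

lemma graph_dist_cycle_graph:
  assumes "n \<ge> 2" "i < n" "j < n"
  shows "int (graph_dist (with_proj (cycle_graph n)) i j) =
    min \<bar>int i - int j\<bar> (int n - \<bar>int i - int j\<bar>)"
proof -
  interpret pair_graph "cycle_graph n" using assms(1) by (rule pair_graph_cycle_graph)
  define D where "D i = \<bar>int i - int j\<bar>" for i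
  define g where "g i = min (D i) (int n - D i)" for i
  have arc: "(x, y) \<in> parcs (cycle_graph n) \<longleftrightarrow> x < n \<and> y < n \<and>
      (y = x + 1 \<or> x = y + 1 \<or> x + 1 = n \<and> y = 0 \<or> y + 1 = n \<and> x = 0)" for x y
    using assms(1) by (cases "x + 1 = n"; cases "y + 1 = n") (auto simp: cycle_graph_def)
  have "graph_dist (with_proj (cycle_graph n)) i j = nat (g i)"
  proof (rule graph_dist_eqI)
    show "i \<in> pverts (cycle_graph n)" using assms by (simp add: pverts_cycle_graph)
    show "nat (g j) = 0" by (simp add: g_def D_def)
  next
    fix x y assume "(x, y) \<in> parcs (cycle_graph n)"
    then have xy: "x < n" "y < n" "y = x + 1 \<or> x = y + 1 \<or> x + 1 = n \<and> y = 0 \<or> y + 1 = n \<and> x = 0"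
      by (simp_all add: arc)
    \<comment> \<open>The second alternative is the arc between \<open>n - 1\<close> and 0.\<close>
    then have "\<bar>D x - D y\<bar> \<le> 1 \<or> D x + D y = int n - 1"
      using assms(3) unfolding D_def by (elim disjE) auto
    then have "g x \<le> g y + 1" unfolding g_def by (auto simp: min_def abs_if split: if_splits)
    moreover have "0 \<le> g y" using xy assms(3) by (simp add: g_def D_def abs_if)
    ultimately show "nat (g x) \<le> Suc (nat (g y))" by linarith
  next
    fix x assume "x \<in> pverts (cycle_graph n)" "x \<noteq> j"
    then have x: "x < n" by (simp add: pverts_cycle_graph)
    define up where "up = (if x + 1 = n then 0 else x + 1)"
    define dn where "dn = (if x = 0 then n - 1 else x - 1)"
    have "(x, up) \<in> parcs (cycle_graph n)" "(x, dn) \<in> parcs (cycle_graph n)"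
      using x assms by (auto simp: arc up_def dn_def)
    moreover have "g up < g x \<or> g dn < g x"
    proof (cases "j < x")
      case True
      have "D dn = D x - 1" using True by (simp add: D_def dn_def)
      moreover have "D up = D x + 1 \<or> D up = int n - D x - 1"
        using True by (auto simp: D_def up_def)
      ultimately show ?thesis unfolding g_def min_def by (auto simp: not_le)
    next
      case False
      then have jx: "x < j" using \<open>x \<noteq> j\<close> by simp
      have "D up = D x - 1" using jx assms(3) by (simp add: D_def up_def)
      moreover have "D dn = D x + 1 \<or> D dn = int n - D x - 1"
        using jx assms by (auto simp: D_def dn_def of_nat_diff)
      ultimately show ?thesis unfolding g_def min_def by (auto simp: not_le)
    qed
    moreover have "0 < g x" using x \<open>x \<noteq> j\<close> assms(3) by (auto simp: g_def D_def abs_if)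
    ultimately show "\<exists>y. (x, y) \<in> parcs (cycle_graph n) \<and> nat (g y) < nat (g x)"
      using zless_nat_conj by blast
  qed
  moreover have "0 \<le> g i" using assms by (simp add: g_def D_def abs_if)
  ultimately show ?thesis by (simp add: g_def D_def)
qed

text \<open>
  The distance to 0 determines a vertex up to the reflection \<open>i \<mapsto> n - i\<close>. Of two distinct
  vertices exchanged by it, the one below \<open>n / 2\<close> is closer to 1, so the distance to 1 decides.
\<close>

lemma resolving_set_cycle_graph:
  assumes "n \<ge> 2"
  shows "resolving_set (with_proj (cycle_graph n)) {0, 1}"
  unfolding resolving_set_def
proof (intro conjI ballI impI)
  show "{0, 1} \<subseteq> verts (with_proj (cycle_graph n))" using assms by (auto simp: pverts_cycle_graph)
  let ?d = "graph_dist (with_proj (cycle_graph n))"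
  fix i j assume "i \<in> verts (with_proj (cycle_graph n))" "j \<in> verts (with_proj (cycle_graph n))" "i \<noteq> j"
  then have ij: "i < n" "j < n" "i \<noteq> j" by (simp_all add: pverts_cycle_graph)
  have d0: "int (?d x 0) = min (int x) (int n - int x)" if "x < n" for x
    using graph_dist_cycle_graph[of n x 0] assms that by simp
  have d1: "int (?d x 1) = (if x = 0 then 1 else min (int x - 1) (int n - int x + 1))" if "x < n" for x
    using graph_dist_cycle_graph[of n x 1] assms that by (auto simp: abs_if)
  have False if "?d i 0 = ?d j 0" "?d i 1 = ?d j 1"
  proof -
    have "min (int i) (int n - int i) = min (int j) (int n - int j)"
      using that(1) d0 ij by metis
    then have sum: "int i + int j = int n" using ij by (auto simp: min_def split: if_splits)
    then have "i \<noteq> 0" "j \<noteq> 0" using ij by auto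
    then have "min (int i - 1) (int n - int i + 1) = min (int j - 1) (int n - int j + 1)"
      using that(2) d1 ij by metis
    then show False using sum ij by (auto simp: min_def split: if_splits)
  qed
  then show "\<exists>t\<in>{0, 1}. ?d i t \<noteq> ?d j t" by blast
qed

section \<open>Andrasfai graphs\<close>

text \<open>
  The diameter is at most 2: let \<open>r\<close> be the residue of \<open>u - v\<close>. If \<open>r\<close> is a nonzero multiple of 3,
  then \<open>u + 1\<close> is a common neighbour of \<open>u\<close> and \<open>v\<close>; if \<open>r \<equiv> 2\<close> modulo 3, then \<open>u - 1\<close> is one.
\<close>

lemma graph_dist_Andrasfai:
  assumes "k \<ge> 1" "u \<in> {0..<3 * int k - 1}" "v \<in> {0..<3 * int k - 1}"
  shows "graph_dist (with_proj (Andrasfai k)) u v =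
    (if u = v then 0 else if (u - v) mod (3 * int k - 1) mod 3 = 1 then 1 else 2)"
proof -
  interpret pair_graph "Andrasfai k" using assms(1) by (rule pair_graph_Andrasfai)
  define m where "m = 3 * int k - 1"
  have m: "m \<ge> 2" "m mod 3 = 2" using assms(1) unfolding m_def by presburger+
  have arc: "(x, y) \<in> parcs (Andrasfai k) \<longleftrightarrow>
      0 \<le> x \<and> x < m \<and> 0 \<le> y \<and> y < m \<and> (x - y) mod m mod 3 = 1" for x y
    using assms(1) by (auto simp: parcs_Andrasfai_iff m_def)
  have uv: "0 \<le> u" "u < m" "0 \<le> v" "v < m" using assms by (simp_all add: m_def)
  let ?f = "\<lambda>u. if u = v then 0 else if (u - v) mod m mod 3 = 1 then 1 else 2 :: nat"
  have "graph_dist (with_proj (Andrasfai k)) u v = ?f u"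
  proof (rule graph_dist_eqI)
    show "u \<in> pverts (Andrasfai k)" using assms by (simp add: pverts_Andrasfai)
    show "?f v = 0" by simp
  next
    fix x y assume "(x, y) \<in> parcs (Andrasfai k)"
    then show "?f x \<le> Suc (?f y)" by (auto simp: arc)
  next
    fix x assume "x \<in> pverts (Andrasfai k)" "x \<noteq> v"
    then have x: "0 \<le> x" "x < m" using assms(1) by (auto simp: pverts_Andrasfai m_def)
    define r where "r = (x - v) mod m"
    have r: "0 \<le> r" "r < m" using m by (simp_all add: r_def)
    have "r \<noteq> 0"
    proof
      assume "r = 0"
      then have "x mod m = v mod m" by (simp add: r_def mod_eq_dvd_iff dvd_eq_mod_eq_0)
      then show False using x uv \<open>x \<noteq> v\<close> by simp
    qed
    consider "r mod 3 = 0" | "r mod 3 = 1" | "r mod 3 = 2" by linarith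
    then show "\<exists>y. (x, y) \<in> parcs (Andrasfai k) \<and> ?f y < ?f x"
    proof cases
      case 2
      then show ?thesis using x uv \<open>x \<noteq> v\<close>
        by (intro exI[of _ v]) (simp add: arc r_def)
    next
      case 1
      define y where "y = (x + 1) mod m"
      have "(x - y) mod m = (- 1) mod m" by (simp add: y_def mod_diff_right_eq)
      moreover have "\<dots> = m - 1" using m by (simp add: zmod_zminus1_eq_if)
      moreover have "(m - 1) mod 3 = 1" using m(2) by presburger
      ultimately have "(x - y) mod m mod 3 = 1" by simp
      then have xy: "(x, y) \<in> parcs (Andrasfai k)" using x m(1) by (simp add: arc y_def)
      have "(y - v) mod m = (x + 1 - v) mod m" by (simp add: y_def mod_diff_left_eq)
      also have "x + 1 - v = (x - v) + 1" by simp
      also have "\<dots> mod m = (r + 1) mod m" by (simp only: r_def mod_add_left_eq)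
      also have "r + 1 < m" using r 1 m by presburger
      then have "(r + 1) mod m = r + 1" using r by simp
      finally have "(y - v) mod m = r + 1" .
      moreover have "(r + 1) mod 3 = 1" using 1 by presburger
      ultimately have "?f y < ?f x" using 1 \<open>x \<noteq> v\<close> by (simp add: r_def)
      with xy show ?thesis by blast
    next
      case 3
      define y where "y = (x - 1) mod m"
      have "(x - y) mod m = 1 mod m" by (simp add: y_def mod_diff_right_eq)
      then have "(x - y) mod m mod 3 = 1" using m(1) by simp
      then have xy: "(x, y) \<in> parcs (Andrasfai k)" using x m(1) by (simp add: arc y_def)
      have "(y - v) mod m = (x - 1 - v) mod m" by (simp add: y_def mod_diff_left_eq)
      also have "x - 1 - v = (x - v) - 1" by simp
      also have "\<dots> mod m = (r - 1) mod m" by (simp only: r_def mod_diff_left_eq)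
      also have "\<dots> = r - 1" using r \<open>r \<noteq> 0\<close> by simp
      finally have "(y - v) mod m = r - 1" .
      moreover have "(r - 1) mod 3 = 1" using 3 by presburger
      ultimately have "?f y < ?f x" using 3 \<open>x \<noteq> v\<close> by (simp add: r_def)
      with xy show ?thesis by blast
    qed
  qed
  then show ?thesis by (simp add: m_def)
qed

lemma card_image_le_Suc_changes:
  "card (f ` {0..<Suc m}) \<le> Suc (card {i. i < m \<and> f (Suc i) \<noteq> f i})"
proof (induction m)
  case 0
  then show ?case by simp
next
  case (Suc m)
  let ?C = "\<lambda>m. {i. i < m \<and> f (Suc i) \<noteq> f i}"
  have im: "f ` {0..<Suc (Suc m)} = insert (f (Suc m)) (f ` {0..<Suc m})"
    by (simp add: atLeast0_lessThan_Suc)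
  show ?case
  proof (cases "f (Suc m) = f m")
    case True
    then have "f ` {0..<Suc (Suc m)} = f ` {0..<Suc m}" "?C (Suc m) = ?C m"
      unfolding im by (auto simp: less_Suc_eq)
    then show ?thesis using Suc by simp
  next
    case False
    then have "?C (Suc m) = insert m (?C m)" by (auto simp: less_Suc_eq)
    then show ?thesis using Suc unfolding im
      by (simp add: card_insert_if)
  qed
qed

lemma inj_on_mult_add_mod:
  fixes a b m :: int
  assumes "coprime a m" 
  shows "inj_on (\<lambda>i. (a * int i + b) mod m) {0..<nat m}"
proof (rule inj_onI)
  fix i j assume ij: "i \<in> {0..<nat m}" "j \<in> {0..<nat m}"
    and "(a * int i + b) mod m = (a * int j + b) mod m"
  then have "m dvd (a * int i + b) - (a * int j + b)" by (simp add: mod_eq_dvd_iff)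
  then have "m dvd a * (int i - int j)" by (simp add: algebra_simps)
  then have "m dvd int i - int j"
    using assms coprime_dvd_mult_right_iff coprime_commute by metis
  then have "int i mod m = int j mod m" by (simp add: mod_eq_dvd_iff)
  then show "i = j" using ij by simp
qed

text \<open>
  The set \<open>N x\<close> of neighbours of \<open>x\<close> in \<open>W\<close> determines \<open>x\<close> among the vertices outside \<open>W\<close>. Since 3 is
  coprime to \<open>m\<close>, the walk \<open>0, 3, 6, \<dots>\<close> modulo \<open>m\<close> visits every vertex once, and \<open>N\<close> can only
  change in the step from \<open>x\<close> to \<open>x + 3\<close> if \<open>x + 1\<close> or \<open>x + 2\<close> is in \<open>W\<close>. Each element of \<open>W\<close> is thus
  responsible for at most two changes.
\<close>

lemma card_le_resolving_set_Andrasfai: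
  assumes "k \<ge> 2" and W: "resolving_set (with_proj (Andrasfai k)) W"
  shows "k \<le> card W"
proof -
  have k1: "k \<ge> 1" using assms(1) by simp
  define m where "m = 3 * int k - 1"
  have m: "m \<ge> 5" "m mod 3 = 2" using assms(1) unfolding m_def by presburger+
  have cop: "coprime 3 m"
  proof (rule coprimeI)
    fix c assume "c dvd 3" "c dvd m"
    then have "c dvd 3 * int k - m" by (intro dvd_diff dvd_mult2)
    then show "is_unit c" by (simp add: m_def)
  qed
  define N where "N x = {w \<in> W. (x - w) mod m mod 3 = 1}" for x
  have sub: "W \<subseteq> {0..<m}"
    using W k1 by (simp add: resolving_set_def pverts_Andrasfai m_def)
  then have fin: "finite W" by (rule finite_subset) simp
  have inj: "inj_on N ({0..<m} - W)"
  proof (rule inj_onI, rule ccontr)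
    fix x y assume xy: "x \<in> {0..<m} - W" "y \<in> {0..<m} - W" "N x = N y" "x \<noteq> y"
    have "x \<in> verts (with_proj (Andrasfai k))" "y \<in> verts (with_proj (Andrasfai k))"
      using xy k1 by (simp_all add: pverts_Andrasfai m_def)
    then obtain w where w: "w \<in> W"
      "graph_dist (with_proj (Andrasfai k)) x w \<noteq> graph_dist (with_proj (Andrasfai k)) y w"
      using W \<open>x \<noteq> y\<close> unfolding resolving_set_def by blast
    have "graph_dist (with_proj (Andrasfai k)) z w = (if w \<in> N z then 1 else 2)"
      if "z \<in> {0..<m} - W" for z
      using that w(1) sub k1 by (subst graph_dist_Andrasfai) (auto simp: N_def m_def)
    then show False using w(2) xy by simp
  qed
  define f where "f i = N (3 * int i)" for i
  have change: "(3 * int i + 1) mod m \<in> W \<or> (3 * int i + 2) mod m \<in> W" if "f (Suc i) \<noteq> f i" for i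
  proof -
    define x where "x = 3 * int i"
    have "N (x + 3) \<noteq> N x" using that by (simp add: f_def x_def algebra_simps)
    then obtain w where w: "w \<in> W"
      "\<not> ((x + 3 - w) mod m mod 3 = 1 \<longleftrightarrow> (x - w) mod m mod 3 = 1)"
      unfolding N_def by blast
    define r where "r = (x - w) mod m"
    have r: "0 \<le> r" "r < m" using m by (simp_all add: r_def)
    have "x + 3 - w = (x - w) + 3" by simp
    then have "(x + 3 - w) mod m = (r + 3) mod m" by (simp only: r_def mod_add_left_eq)
    moreover have "(r + 3) mod m = (if r + 3 < m then r + 3 else r + 3 - m)"
    proof (cases "r + 3 < m")
      case False
      have "(r + 3) mod m = (r + 3 - m) mod m" by simp
      also have "\<dots> = r + 3 - m" using False r m by (intro mod_pos_pos_trivial) auto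
      finally show ?thesis using False by simp
    qed (use r in simp)
    ultimately have diff: "\<not> ((if r + 3 < m then r + 3 else r + 3 - m) mod 3 = 1 \<longleftrightarrow> r mod 3 = 1)"
      using w(2) by (simp add: r_def)
    \<comment> \<open>Adding 3 keeps the residue modulo 3 unless it wraps around \<open>m\<close>, and wrapping from
      \<open>m - 3\<close>, which is 2 modulo 3, to 0 leaves \<open>x\<close> a non-neighbour of \<open>w\<close>.\<close>
    have "r + 1 = m \<or> r + 2 = m"
    proof (rule ccontr)
      assume "\<not> (r + 1 = m \<or> r + 2 = m)"
      then consider "r + 3 < m" | "r = m - 3" using r by linarith
      then show False
      proof cases
        case 1
        then show False using diff by simp
      next
        case 2
        have "(m - 3) mod 3 \<noteq> 1" using m(2) by presburger
        then show False using diff 2 by simp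
      qed
    qed
    moreover have "(x + c) mod m = w" if "r + c = m" for c
    proof -
      have "(x - w + c) mod m = (r + c) mod m" by (simp only: r_def mod_add_left_eq)
      then have 0: "(x - w + c) mod m = 0" using that by simp
      have "x + c = w + (x - w + c)" by simp
      then have "(x + c) mod m = (w + (x - w + c) mod m) mod m" by (simp only: mod_add_right_eq)
      also have "\<dots> = w" using 0 w(1) sub by auto
      finally show ?thesis .
    qed
    ultimately have "(x + 1) mod m = w \<or> (x + 2) mod m = w" by force
    then show ?thesis using w(1) by (auto simp: x_def)
  qed
  let ?M = "nat m"
  have inj3: "inj_on (\<lambda>i. (3 * int i + b) mod m) {0..<?M}" for b
    by (rule inj_on_mult_add_mod[OF cop])
  have A: "card {i. i < ?M - 1 \<and> (3 * int i + b) mod m \<in> W} \<le> card W" for b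
    by (rule card_inj_on_le[OF inj_on_subset[OF inj3[of b]] _ fin]) auto
  have "{0..<m} \<subseteq> (\<lambda>i. (3 * int i + 0) mod m) ` {0..<?M}"
  proof -
    have "card ((\<lambda>i. (3 * int i + 0) mod m) ` {0..<?M}) = card {0..<m}"
      using card_image[OF inj3[of 0]] by simp
    moreover have "(\<lambda>i. (3 * int i + 0) mod m) ` {0..<?M} \<subseteq> {0..<m}" using m by auto
    ultimately show ?thesis using card_subset_eq by (metis finite_atLeastLessThan_int order_refl)
  qed
  moreover have "N ((3 * int i + 0) mod m) = f i" for i by (simp add: N_def f_def mod_diff_left_eq)
  ultimately have "N ` ({0..<m} - W) \<subseteq> f ` {0..<?M}" by blast
  then have "card ({0..<m} - W) \<le> card (f ` {0..<?M})"
    using card_image[OF inj] by (metis card_mono finite_atLeastLessThan finite_imageI)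
  also have "\<dots> \<le> Suc (card {i. i < ?M - 1 \<and> f (Suc i) \<noteq> f i})"
    using card_image_le_Suc_changes[of f "?M - 1"] m by (simp add: Suc_diff_le)
  also have "card {i. i < ?M - 1 \<and> f (Suc i) \<noteq> f i} \<le>
      card ({i. i < ?M - 1 \<and> (3 * int i + 1) mod m \<in> W} \<union> {i. i < ?M - 1 \<and> (3 * int i + 2) mod m \<in> W})"
    using change by (intro card_mono) auto
  also have "\<dots> \<le> card W + card W"
    by (rule order_trans[OF card_Un_le add_mono[OF A A]])
  finally have "card ({0..<m} - W) \<le> Suc (card W + card W)" by simp
  moreover have "card ({0..<m} - W) = ?M - card W" using fin sub by (simp add: card_Diff_subset)
  ultimately show ?thesis by (simp add: m_def)
qed

text \<open>
  Without wrapping, \<open>x - 3j\<close> is congruent to \<open>x\<close> modulo 3; with wrapping, \<open>m \<equiv> 2\<close> is added, so that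
  the vertices congruent to 2 become the neighbours.
\<close>

lemma graph_dist_Andrasfai_mult_3:
  assumes "x \<in> {0..<3 * int k - 1}" "j < k"
  shows "graph_dist (with_proj (Andrasfai k)) x (3 * int j) =
    (if x mod 3 = 0 then if x = 3 * int j then 0 else 2
     else if x mod 3 = 1 \<longleftrightarrow> 3 * int j \<le> x then 1 else 2)"
proof -
  define m where "m = 3 * int k - 1"
  have j: "3 * int j \<in> {0..<m}" using assms by (simp add: m_def)
  have x: "0 \<le> x" "x < m" using assms by (simp_all add: m_def)
  have m: "m mod 3 = 2" unfolding m_def by presburger
  have adj: "(x - 3 * int j) mod m mod 3 = 1 \<longleftrightarrow>
      x mod 3 = 1 \<and> 3 * int j \<le> x \<or> x mod 3 = 2 \<and> x < 3 * int j"
  proof (cases "3 * int j \<le> x")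
    case True
    then have "(x - 3 * int j) mod m = x - 3 * int j" using x by simp
    moreover have "(x - 3 * int j) mod 3 = x mod 3" by presburger
    ultimately show ?thesis using True by simp
  next
    case False
    have "(x - 3 * int j) mod m = (x - 3 * int j + m) mod m" by simp
    also have "\<dots> = x - 3 * int j + m" using False x j by (intro mod_pos_pos_trivial) auto
    finally have "(x - 3 * int j) mod m = x - 3 * int j + m" .
    moreover have "(x - 3 * int j + m) mod 3 = 1 \<longleftrightarrow> x mod 3 = 2" using m by presburger
    ultimately show ?thesis using False by simp
  qed
  have "x \<noteq> 3 * int j" if "x mod 3 \<noteq> 0" using that by auto
  moreover have "x mod 3 = 0 \<or> x mod 3 = 1 \<or> x mod 3 = 2" by presburger
  moreover have "graph_dist (with_proj (Andrasfai k)) x (3 * int j) =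
      (if x = 3 * int j then 0 else if (x - 3 * int j) mod m mod 3 = 1 then 1 else 2)"
    using assms j by (subst graph_dist_Andrasfai) (auto simp: m_def)
  ultimately show ?thesis unfolding adj by auto
qed

text \<open>
  Here \<open>d x\<close> is the distance vector of \<open>x\<close> to \<open>{0, 3, \<dots>, 3(k - 1)}\<close>, and \<open>P x y\<close> says that the vectors
  of \<open>x\<close> and \<open>y\<close> do not differ by a constant. The equations \<open>d0\<close>, \<open>d1\<close>, \<open>d2\<close> give the vectors for
  the three residues of \<open>x\<close> modulo 3, and each \<open>P\<close> fact exhibits two entries at which two such vectors
  have different differences.
\<close>

lemma doubly_resolving_set_Andrasfai:
  assumes "k \<ge> 2"
  shows "doubly_resolving_set (with_proj (Andrasfai k)) ((\<lambda>j. 3 * int j) ` {0..<k})"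
proof -
  let ?V = "{0..<3 * int k - 1}"
  define d where "d x j = int (graph_dist (with_proj (Andrasfai k)) x (3 * int j))" for x j
  define P where "P x y \<longleftrightarrow> (\<exists>i<k. \<exists>j<k. d x i - d y i \<noteq> d x j - d y j)" for x y
  have PI: "P x y" if "i < k" "j < k" "d x i - d y i \<noteq> d x j - d y j" for x y i j
    using that unfolding P_def by blast
  have P_sym: "P y x" if xy: "P x y" for x y
  proof -
    obtain i j where "i < k" "j < k" "d x i - d y i \<noteq> d x j - d y j"
      using xy unfolding P_def by blast
    then show ?thesis by (intro PI[of i j]) linarith+
  qed
  have d0: "d (3 * int a) j = (if j = a then 0 else 2)" if "a < k" "j < k" for a j
    using graph_dist_Andrasfai_mult_3[of "3 * int a" k j] that by (auto simp: d_def)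
  have d1: "d (3 * int a + 1) j = (if j \<le> a then 1 else 2)" if "a < k" "j < k" for a j
  proof -
    have "(3 * int a + 1) mod 3 = 1" "3 * int j \<le> 3 * int a + 1 \<longleftrightarrow> j \<le> a" by presburger+
    then show ?thesis
      using graph_dist_Andrasfai_mult_3[of "3 * int a + 1" k j] that by (simp add: d_def)
  qed
  \<comment> \<open>The largest vertex is \<open>3k - 2\<close>, so \<open>3a + 2\<close> is a vertex only for \<open>a < k - 1\<close>; hence the last entry is 1.\<close>
  have d2: "d (3 * int a + 2) j = (if j \<le> a then 2 else 1)" if "Suc a < k" "j < k" for a j
  proof -
    have "(3 * int a + 2) mod 3 = 2" "3 * int j \<le> 3 * int a + 2 \<longleftrightarrow> j \<le> a" by presburger+
    then show ?thesis
      using graph_dist_Andrasfai_mult_3[of "3 * int a + 2" k j] that by (simp add: d_def)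
  qed
  have 0: "0 < k" and last: "k - 1 < k" using assms by simp_all
  have P00: "P (3 * int a) (3 * int b)" if "a < k" "b < k" "a \<noteq> b" for a b
    using that by (intro PI[of a b]) (simp_all add: d0)
  have P0: "P (3 * int a) y" if "a < k" "\<And>j. j < k \<Longrightarrow> d y j \<in> {1, 2}" for a y
  proof -
    \<comment> \<open>Any index other than \<open>a\<close> will do: \<open>d (3a) c - d (3a) a = 2\<close>, while entries in
      \<open>{1, 2}\<close> differ by at most 1.\<close>
    define c where "c = (if a = 0 then 1 else 0 :: nat)"
    have c: "c < k" "c \<noteq> a" using assms by (auto simp: c_def)
    show ?thesis
      using that(1) c(2) that(2)[OF that(1)] that(2)[OF c(1)] c(1)
      by (intro PI[OF that(1) c(1)]) (auto simp: d0)
  qed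
  have P11: "P (3 * int a + 1) (3 * int b + 1)" if "a < k" "b < k" "a < b" for a b
    using that 0 by (intro PI[of 0 b]) (simp_all add: d1)
  have P22: "P (3 * int a + 2) (3 * int b + 2)" if "Suc a < k" "Suc b < k" "a < b" for a b
    using that 0 by (intro PI[of 0 b]) (simp_all add: d2)
  have P12: "P (3 * int a + 1) (3 * int b + 2)" if "a < k" "Suc b < k" for a b
    using that 0 last by (intro PI[OF 0 last]) (auto simp: d1 d2)
  have form: "(\<exists>a<k. x = 3 * int a) \<or> (\<exists>a<k. x = 3 * int a + 1) \<or> (\<exists>a. Suc a < k \<and> x = 3 * int a + 2)"
    if "x \<in> ?V" for x
  proof -
    define a where "a = nat (x div 3)"
    have a: "x = 3 * int a + x mod 3" using that by (simp add: a_def)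
    have "x mod 3 = 0 \<or> x mod 3 = 1 \<or> x mod 3 = 2" by presburger
    then show ?thesis
    proof (elim disjE)
      assume "x mod 3 = 0"
      then have "x = 3 * int a" "a < k" using a that by auto
      then show ?thesis by blast
    next
      assume "x mod 3 = 1"
      then have "x = 3 * int a + 1" "a < k" using a that by auto
      then show ?thesis by blast
    next
      assume "x mod 3 = 2"
      then have "x = 3 * int a + 2" "Suc a < k" using a that by auto
      then show ?thesis by blast
    qed
  qed
  have d12: "d (3 * int a + 1) j \<in> {1, 2}" if "a < k" "j < k" for a j
    using that by (simp add: d1)
  have d22: "d (3 * int a + 2) j \<in> {1, 2}" if "Suc a < k" "j < k" for a j
    using that by (simp add: d2)
  have "P x y" if xy: "x \<in> ?V" "y \<in> ?V" "x \<noteq> y" for x y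
    using form[OF xy(1)] form[OF xy(2)]
  proof (elim disjE exE conjE)
    fix a b assume "a < k" "x = 3 * int a" "b < k" "y = 3 * int b"
    then show ?thesis using P00 xy(3) by auto
  next
    fix a b assume "a < k" "x = 3 * int a" "b < k" "y = 3 * int b + 1"
    then show ?thesis using P0 d12 by blast
  next
    fix a b assume "a < k" "x = 3 * int a" "Suc b < k" "y = 3 * int b + 2"
    then show ?thesis using P0 d22 by blast
  next
    fix a b assume "a < k" "x = 3 * int a + 1" "b < k" "y = 3 * int b"
    then show ?thesis using P0 d12 P_sym by blast
  next
    fix a b assume ab: "a < k" "x = 3 * int a + 1" "b < k" "y = 3 * int b + 1"
    then have "a < b \<or> b < a" using xy(3) by auto
    then show ?thesis using P11 P_sym ab by blast
  next
    fix a b assume "a < k" "x = 3 * int a + 1" "Suc b < k" "y = 3 * int b + 2"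
    then show ?thesis using P12 by blast
  next
    fix a b assume "Suc a < k" "x = 3 * int a + 2" "b < k" "y = 3 * int b"
    then show ?thesis using P0 d22 P_sym by blast
  next
    fix a b assume "Suc a < k" "x = 3 * int a + 2" "b < k" "y = 3 * int b + 1"
    then show ?thesis using P12 P_sym by blast
  next
    fix a b assume ab: "Suc a < k" "x = 3 * int a + 2" "Suc b < k" "y = 3 * int b + 2"
    then have "a < b \<or> b < a" using xy(3) by auto
    then show ?thesis using P22 P_sym ab by blast
  qed
  then show ?thesis using assms unfolding doubly_resolving_set_def P_def d_def
    by (auto simp: pverts_Andrasfai Bex_def)
qed

section \<open>The metric dimension of the product\<close>

theorem proposition2p1:
  fixes k n :: nat
  assumes "k \<ge> 3" and "n \<ge> 3"
  shows "k \<le> metric_dimension (with_proj (Andrasfai k \<box> cycle_graph n)) \<and>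
    metric_dimension (with_proj (Andrasfai k \<box> cycle_graph n)) \<le> k + 1"
proof
  have k: "k \<ge> 1" "k \<ge> 2" and n: "n \<ge> 2" using assms by simp_all
  note pg = pair_graph_Andrasfai[OF k(1)] pair_graph_cycle_graph[OF n]
  note sc = strongly_connected_Andrasfai[OF k(1)] strongly_connected_cycle_graph[OF n]
  interpret GH: pair_graph "Andrasfai k \<box> cycle_graph n" by (rule pair_graph_cartesian_product[OF pg])
  obtain W where W: "resolving_set (with_proj (Andrasfai k \<box> cycle_graph n)) W"
    "card W = metric_dimension (with_proj (Andrasfai k \<box> cycle_graph n))"
    using GH.metric_dimension_attained strongly_connected_cartesian_product[OF pg sc] by blast
  have "W \<subseteq> pverts (Andrasfai k \<box> cycle_graph n)" using W(1) by (simp add: resolving_set_def)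
  then have "finite W" using GH.pair_finite_verts finite_subset by blast
  have "k \<le> card (fst ` W)"
    by (rule card_le_resolving_set_Andrasfai[OF k(2) resolving_set_fst_image[OF pg sc W(1)]])
  also have "\<dots> \<le> card W" using \<open>finite W\<close> by (rule card_image_le)
  finally show "k \<le> metric_dimension (with_proj (Andrasfai k \<box> cycle_graph n))" using W(2) by simp
next
  have k: "k \<ge> 1" "k \<ge> 2" and n: "n \<ge> 2" using assms by simp_all
  let ?S = "(\<lambda>j. 3 * int j) ` {0..<k}" and ?T = "{0, 1 :: nat}"
  have "resolving_set (with_proj (Andrasfai k \<box> cycle_graph n)) (?S \<times> {0} \<union> {0} \<times> ?T)"
    using k(1) by (intro resolving_set_cartesian_product
        pair_graph_Andrasfai[OF k(1)] pair_graph_cycle_graph[OF n]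
        strongly_connected_Andrasfai[OF k(1)] strongly_connected_cycle_graph[OF n]
        doubly_resolving_set_Andrasfai[OF k(2)] resolving_set_cycle_graph[OF n])
      (auto simp: image_iff intro: bexI[of _ 0])
  then have "metric_dimension (with_proj (Andrasfai k \<box> cycle_graph n)) \<le>
      card (?S \<times> {0} \<union> {0} \<times> ?T)" by (rule metric_dimension_le)
  moreover have "card (?S \<times> {0} \<union> {0} \<times> ?T) + 1 = card ?S + card ?T"
    using k(1) by (intro card_resolving_set_cartesian_product) (auto simp: image_iff intro: bexI[of _ 0])
  moreover have "card ?S = k" by (simp add: card_image inj_on_def)
  ultimately show "metric_dimension (with_proj (Andrasfai k \<box> cycle_graph n)) \<le> k + 1" by simp
qed

end
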